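(* Let $F\in\mathcal F_1(I)$ be strictly increasing, let $c_i\in J(F)$ satisfy $J(F)\cap F(c_i)=\{c_i\}$, suppose the set $F(c_i)$ is a compact interval, and let $f^*$ be a map on $I\setminus J(F)$ of the form described in the context. If $$J(F)\cap\left(\lim_{x\to c_i+}f^*(x),\ \lim_{x\to c_i-}f^*(x)\right)=\{c_i\},$$ then the multifunction $$f(x):=\begin{cases} f^*(x), & x\in I\setminus J(F),\\ \left[\lim_{s\to c_i+}f^*(s),\ \lim_{s\to c_i-}f^*(s)\right], & x=c_i,\end{cases}$$ is a strictly decreasing usc square iterative root of $F$ on $(I\setminus J(F))\cup\{c_i\}$.
   Context: Let $I=[a,b]\subset\mathbb R$, $a<b$. A multifunction $F:I\to 2^I$ assigns to each $x\in I$ a nonempty subset $F(x)\subset I$ (singletons are identified with their elements); $F(A)=\bigcup_{x\in A}F(x)$, $(G\circ F)(x)=G(F(x))$, $F^0(x)=\{x\}$, $F^n=F\circ F^{n-1}$. $F$ is upper semi-continuous (usc) at $x_0$ if for every open $V\subset\mathbb R$ with $F(x_0)\subset V$ there is a neighborhood $U$ of $x_0$ such that $F(x)\subset V$ for all $x\in U$ in the domain; usc means usc at every point. $F$ is strictly increasing (resp. strictly decreasing) if $\max F(x)<\min F(y)$ (resp. $\min F(x)>\max F(y)$) whenever $x<y$ in the domain; strictly monotone means one of these. $\mathcal F(I)$ is the class of strictly monotone usc multifunctions $I\to 2^I$. A jump of $F$ is a point $x_0\in I$ with $\#F(x_0)\ge 2$; $J(F)$ is the set of jumps. For $F\in\mathcal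 F(I)$ with finitely many jumps, the intensity $\zeta(F)$ is the least integer $k\ge 0$ with $\#J(F^k)=\#J(F^{k+1})$ (and $+\infty$ if there is none). $\mathcal F_1(I)$ is the set of $F\in\mathcal F(I)$ with finitely many jumps and $\zeta(F)=1$. For $F\in\mathcal F_1(I)$ write $J(F)=\{c_1,\dots,c_m\}$ with the standing convention $a=:c_0<c_1<\dots<c_m<c_{m+1}:=b$, put $I_i:=(c_i,c_{i+1})$ and $I(F):=\{I_i: i=0,\dots,m\}$; $F$ is single-valued and continuous on each $I_i$ and maps $I\setminus J(F)$ into itself. For strictly increasing $F\in\mathcal F_1(I)$, $\Lambda(F)$ is the set of all $J\in I(F)$ with $F(J)\subset J$. For $D\subset I$, a square iterative root of $F$ on $D$ is a (multi)function $f$ from $D$ to nonempty subsets of $D$ with $f^2(x)=F(x)$ for all $x\in D$. The map $f^*$: $f^*:I\setminus J(F)\to I\setminus J(F)$ is a single-valued continuous strictly decreasing square iterative root of $F$ on $I\setminus J(F)$ obtained by extending a strictly decreasing square iterative root $\psi$ of $F$ on $\bigcup_{J\in\Lambda(F)}J$: $f^*=\psi$ on $\bigcup_{J\in\Lambda(F)}J$, and for each $I_j\in I(F)\setminus\Lambda(F)$, $f^*=F|_{I_{j_1}}^{-1}\circ f^*\circ F|_{I_j}$ on $I_j$, where $I_{j_1}\in I(F)$ is the interval containing $f^*(I_j)$ (when $F(I_j)$ lies in a member of $\Lambda(F)$ the middle factor is $\psi$). *)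

theory Defs
  imports "HOL-Analysis.Analysis" "HOL-Library.Extended_Nat"
begin

text \<open>
  A multifunction on \<open>D\<close> is a total function \<open>real \<Rightarrow> real set\<close> of which only the values on \<open>D\<close>
  matter. A single-valued map \<open>g\<close> is identified with \<open>\<lambda>x. {g x}\<close>.
\<close>

definition multifun_on :: "real set \<Rightarrow> (real \<Rightarrow> real set) \<Rightarrow> bool" where
  "multifun_on D F \<longleftrightarrow> (\<forall>x\<in>D. F x \<noteq> {} \<and> F x \<subseteq> D)"

definition usc_on :: "real set \<Rightarrow> (real \<Rightarrow> real set) \<Rightarrow> bool" where
  "usc_on D F \<longleftrightarrow>
     (\<forall>x0\<in>D. \<forall>V. open V \<and> F x0 \<subseteq> V \<longrightarrow>
        (\<exists>U. open U \<and> x0 \<in> U \<and> (\<forall>x\<in>U \<inter> D. F x \<subseteq> V)))"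

text \<open>
  Strict monotonicity is \<open>max (F x) < min (F y)\<close>, respectively \<open>min (F x) > max (F y)\<close>, including
  the existence of these extrema. (\<^const>\<open>Max\<close> and \<^const>\<open>Min\<close> only make sense for finite sets.)
\<close>

definition strictly_increasing_on :: "real set \<Rightarrow> (real \<Rightarrow> real set) \<Rightarrow> bool" where
  "strictly_increasing_on D F \<longleftrightarrow>
     (\<forall>x\<in>D. \<forall>y\<in>D. x < y \<longrightarrow>
        (\<exists>M\<in>F x. \<exists>m\<in>F y. (\<forall>s\<in>F x. s \<le> M) \<and> (\<forall>t\<in>F y. m \<le> t) \<and> M < m))"

definition strictly_decreasing_on :: "real set \<Rightarrow> (real \<Rightarrow> real set) \<Rightarrow> bool" where
  "strictly_decreasing_on D F \<longleftrightarrow>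
     (\<forall>x\<in>D. \<forall>y\<in>D. x < y \<longrightarrow>
        (\<exists>m\<in>F x. \<exists>M\<in>F y. (\<forall>s\<in>F x. m \<le> s) \<and> (\<forall>t\<in>F y. t \<le> M) \<and> m > M))"

definition monotone_usc :: "real set \<Rightarrow> (real \<Rightarrow> real set) set" where
  "monotone_usc D = {F. multifun_on D F \<and> usc_on D F \<and>
     (strictly_increasing_on D F \<or> strictly_decreasing_on D F)}"

fun miter :: "(real \<Rightarrow> real set) \<Rightarrow> nat \<Rightarrow> real \<Rightarrow> real set" where
  "miter F 0 x = {x}"
| "miter F (Suc n) x = (\<Union>y\<in>miter F n x. F y)"

text \<open>
  At least two values; \<open>card (F x) \<ge> 2\<close> would wrongly exclude infinite values.
\<close>

definition jumps :: "real set \<Rightarrow> (real \<Rightarrow> real set) \<Rightarrow> real set" where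
  "jumps D F = {x\<in>D. \<exists>u\<in>F x. \<exists>v\<in>F x. u \<noteq> v}"

text \<open>
  Used only for strictly monotone \<open>F\<close> with finitely many jumps. Then every iterate has finitely many
  jumps, because a point lies in \<open>F x\<close> for at most one \<open>x\<close>, so \<^const>\<open>card\<close> counts correctly.
\<close>

definition intensity :: "real set \<Rightarrow> (real \<Rightarrow> real set) \<Rightarrow> enat" where
  "intensity D F =
     (if \<exists>k. card (jumps D (miter F k)) = card (jumps D (miter F (Suc k)))
      then enat (LEAST k. card (jumps D (miter F k)) = card (jumps D (miter F (Suc k))))
      else \<infinity>)"

definition monotone_usc1 :: "real set \<Rightarrow> (real \<Rightarrow> real set) set" where
  "monotone_usc1 D = {F \<in> monotone_usc D. finite (jumps D F) \<and> intensity D F = 1}"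

text \<open>
  The intervals between consecutive elements of \<open>a = c\<^sub>0 < c\<^sub>1 < \<dots> < c\<^sub>m < c\<^sub>m\<^sub>+\<^sub>1 = b\<close>, where
  \<open>c\<^sub>1, \<dots>, c\<^sub>m\<close> are the jumps.
\<close>

definition jump_intervals :: "real \<Rightarrow> real \<Rightarrow> (real \<Rightarrow> real set) \<Rightarrow> real set set" where
  "jump_intervals a b F =
     {{u<..<v} | u v. u \<in> insert a (insert b (jumps {a..b} F)) \<and>
                      v \<in> insert a (insert b (jumps {a..b} F)) \<and>
                      u < v \<and> {u<..<v} \<inter> jumps {a..b} F = {}}"

definition invariant_intervals :: "real \<Rightarrow> real \<Rightarrow> (real \<Rightarrow> real set) \<Rightarrow> real set set" where
  "invariant_intervals a b F = {J \<in> jump_intervals a b F. (\<Union>x\<in>J. F x) \<subseteq> J}"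

definition square_root_on ::
  "real set \<Rightarrow> (real \<Rightarrow> real set) \<Rightarrow> (real \<Rightarrow> real set) \<Rightarrow> bool" where
  "square_root_on D F f \<longleftrightarrow> multifun_on D f \<and> (\<forall>x\<in>D. miter f 2 x = F x)"

text \<open>
  \<open>fs\<close> is the map \<open>f\<^sup>*\<close> extending \<open>\<psi>\<close>. Off the jumps \<open>F x\<close> is a singleton, so \<open>the_elem (F x)\<close>
  is its value. In the last clause \<open>K\<close> is the interval \<open>I\<^sub>j\<^sub>1\<close> containing \<open>f\<^sup>*(I\<^sub>j)\<close>.
\<close>

definition root_extension ::
  "real \<Rightarrow> real \<Rightarrow> (real \<Rightarrow> real set) \<Rightarrow> (real \<Rightarrow> real) \<Rightarrow> (real \<Rightarrow> real) \<Rightarrow> bool" where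
  "root_extension a b F \<psi> fs \<longleftrightarrow>
     strict_antimono_on (\<Union>(invariant_intervals a b F)) \<psi> \<and>
     square_root_on (\<Union>(invariant_intervals a b F)) F (\<lambda>x. {\<psi> x}) \<and>
     continuous_on ({a..b} - jumps {a..b} F) fs \<and>
     strict_antimono_on ({a..b} - jumps {a..b} F) fs \<and>
     square_root_on ({a..b} - jumps {a..b} F) F (\<lambda>x. {fs x}) \<and>
     (\<forall>x\<in>\<Union>(invariant_intervals a b F). fs x = \<psi> x) \<and>
     (\<forall>L\<in>jump_intervals a b F - invariant_intervals a b F.
        \<exists>K\<in>jump_intervals a b F. fs ` L \<subseteq> K \<and>
          (\<forall>x\<in>L. fs x = the_inv_into K (\<lambda>t. the_elem (F t)) (fs (the_elem (F x)))))"

end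

theory Submission
  imports Defs
begin

text \<open>
  Let \<open>l < c < r\<close> be the right and left limits of \<open>f\<^sup>*\<close> at \<open>c\<close>. A regular \<open>x < c\<close> has
  \<open>f\<^sup>* x > r > c\<close>, so \<open>F x = f\<^sup>* (f\<^sup>* x) < l\<close>; letting \<open>x\<close> tend to \<open>c\<close> gives \<open>min (F c) \<le> l\<close>, and
  symmetrically \<open>r \<le> max (F c)\<close>. Hence \<open>[l, r] \<subseteq> F c\<close>, which contains no jump but \<open>c\<close>. So \<open>f\<^sup>*\<close> is
  continuous at \<open>l\<close> and \<open>r\<close>, with \<open>f\<^sup>* l = max (F c)\<close> and \<open>f\<^sup>* r = min (F c)\<close>, and \<open>f\<close> maps \<open>[l, c)\<close>,
  \<open>c\<close> and \<open>(c, r]\<close> onto \<open>(r, max (F c)]\<close>, \<open>[l, r]\<close> and \<open>[min (F c), l)\<close>, which together make up \<open>F c\<close>.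
\<close>

text \<open>The limit is the infimum of \<open>f\<close> over \<open>{u<..<c}\<close>, to which a
  decreasing function converges at \<open>c\<close>. The bound covers every point of
  \<open>S\<close> left of \<open>c\<close>, not only those near \<open>c\<close>: later it is
  applied to points such as \<open>fs x\<close> that may lie in a remote component of
  \<open>S\<close>.\<close>

lemma strict_antimono_on_tendsto_at_left:
  fixes f :: "real \<Rightarrow> real"
  assumes anti: "strict_antimono_on S f" and bdd: "bdd_below (f ` S)"
    and "u < c" and sub: "{u<..<c} \<subseteq> S"
  obtains r where "(f \<longlongrightarrow> r) (at_left c)" and "\<And>x. x \<in> S \<Longrightarrow> x < c \<Longrightarrow> r < f x"
proof -
  define r where "r = Inf (f ` {u<..<c})"
  have dec: "f y < f x" if "x \<in> S" "y \<in> S" "x < y" for x y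
    using anti that by (auto simp: monotone_on_def)
  have bdd': "bdd_below (f ` {u<..<c})"
    using bdd sub by (meson bdd_below_mono image_mono)
  have le: "r \<le> f x" if "x \<in> {u<..<c}" for x
    unfolding r_def using bdd' that by (intro cInf_lower) auto
  have less: "r < f x" if "x \<in> S" "x < c" for x
  proof -
    \<comment> \<open>The point \<open>x\<close> may lie left of \<open>u\<close>, outside the
      interval defining \<open>r\<close>. An intermediate \<open>y\<close> inside that interval
      links the two and makes the inequality strict.\<close>
    have "max u x < c" using \<open>u < c\<close> that by simp
    then obtain y where y: "max u x < y" "y < c"
      using dense by blast
    then have "r \<le> f y" by (intro le) auto
    moreover have "f y < f x" using y sub that by (intro dec) auto
    ultimately show ?thesis by simp
  qed
  have "(f \<longlongrightarrow> r) (at_left c)"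
  proof (rule order_tendstoI)
    fix e assume "e < r"
    have "eventually (\<lambda>x. x \<in> {u<..<c}) (at_left c)"
      using \<open>u < c\<close> by (intro eventually_at_leftI[of u]) auto
    then show "eventually (\<lambda>x. e < f x) (at_left c)"
      by eventually_elim (use le \<open>e < r\<close> in fastforce)
  next
    fix e assume "r < e"
    moreover have "f ` {u<..<c} \<noteq> {}" using \<open>u < c\<close> by simp
    ultimately have "\<exists>z\<in>f ` {u<..<c}. z < e"
      unfolding r_def by (intro cInf_lessD)
    then obtain y where y: "y \<in> {u<..<c}" "f y < e" by blast
    have "f x < e" if "x \<in> {y<..<c}" for x
    proof -
      have "f x < f y" using that y sub by (intro dec) auto
      with y show ?thesis by simp
    qed
    then show "eventually (\<lambda>x. f x < e) (at_left c)"
      using y by (intro eventually_at_leftI[of y]) auto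
  qed
  with less that show thesis by blast
qed

text \<open>Conjugating by negation keeps a function decreasing but exchanges left and right at
  \<open>c\<close>, so the right-hand versions below follow from the left-hand ones.\<close>

lemma strict_antimono_on_reflect:
  fixes f :: "real \<Rightarrow> real"
  assumes "strict_antimono_on S f"
  shows "strict_antimono_on (uminus ` S) (\<lambda>x. - f (- x))"
  using assms by (auto simp: monotone_on_def)

lemma tendsto_at_left_reflect:
  fixes f :: "real \<Rightarrow> real"
  shows "((\<lambda>x. - f (- x)) \<longlongrightarrow> - l) (at_left (- c)) \<longleftrightarrow> (f \<longlongrightarrow> l) (at_right c)"
  by (simp add: at_left_minus[of "- c"] filterlim_filtermap tendsto_minus_cancel_left[symmetric])

lemma strict_antimono_on_tendsto_at_right:
  fixes f :: "real \<Rightarrow> real"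
  assumes anti: "strict_antimono_on S f" and bdd: "bdd_above (f ` S)"
    and "c < v" and sub: "{c<..<v} \<subseteq> S"
  obtains l where "(f \<longlongrightarrow> l) (at_right c)" and "\<And>x. x \<in> S \<Longrightarrow> c < x \<Longrightarrow> f x < l"
proof -
  have "bdd_below ((\<lambda>x. - f (- x)) ` uminus ` S)"
    using bdd by (simp add: image_image bdd_below_uminus[symmetric])
  moreover have "{- v<..<- c} \<subseteq> uminus ` S"
    using image_mono[OF sub, of uminus] by simp
  ultimately obtain r where r: "((\<lambda>x. - f (- x)) \<longlongrightarrow> r) (at_left (- c))"
    "\<And>x. x \<in> uminus ` S \<Longrightarrow> x < - c \<Longrightarrow> r < - f (- x)"
    using strict_antimono_on_tendsto_at_left[OF strict_antimono_on_reflect[OF anti]] \<open>c < v\<close>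
    by (metis neg_less_iff_less)
  have "(f \<longlongrightarrow> - r) (at_right c)"
    using r(1) tendsto_at_left_reflect[of f "- r" c] by simp
  moreover have "f x < - r" if "x \<in> S" "c < x" for x
    using r(2)[of "- x"] that by simp
  ultimately show thesis using that by blast
qed

text \<open>For \<open>y\<close> above the limit \<open>r\<close> some \<open>x\<close> close to
  \<open>c\<close> has \<open>f x < y\<close>, and the intermediate value theorem on
  \<open>{u..x}\<close> yields a preimage. The value \<open>r\<close> itself is never
  attained.\<close>

lemma strict_antimono_on_image_at_left:
  fixes f :: "real \<Rightarrow> real"
  assumes anti: "strict_antimono_on {u..<c} f" and cont: "continuous_on {u..<c} f"
    and lim: "(f \<longlongrightarrow> r) (at_left c)" and gt: "\<And>x. x \<in> {u..<c} \<Longrightarrow> r < f x" and "u < c"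
  shows "f ` {u..<c} = {r<..f u}"
proof
  show "f ` {u..<c} \<subseteq> {r<..f u}"
    using gt anti by (fastforce simp: monotone_on_def le_less)
  show "{r<..f u} \<subseteq> f ` {u..<c}"
  proof
    fix y assume y: "y \<in> {r<..f u}"
    have "eventually (\<lambda>x. f x < y) (at_left c)"
      using lim y by (intro order_tendstoD) auto
    moreover have "eventually (\<lambda>x. x \<in> {u<..<c}) (at_left c)"
      using \<open>u < c\<close> by (intro eventually_at_leftI[of u]) auto
    ultimately have "eventually (\<lambda>x. f x < y \<and> x \<in> {u<..<c}) (at_left c)"
      by eventually_elim simp
    then obtain x where x: "f x < y" "x \<in> {u<..<c}"
      using eventually_happens trivial_limit_at_left_real by blast
    have "continuous_on {u..x} f"
      using cont x by (auto intro: continuous_on_subset)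
    then obtain z where "u \<le> z" "z \<le> x" "f z = y"
      using IVT2'[of f x y u] x y by auto
    then show "y \<in> f ` {u..<c}" using x by auto
  qed
qed

lemma strict_antimono_on_image_at_right:
  fixes f :: "real \<Rightarrow> real"
  assumes anti: "strict_antimono_on {c<..v} f" and cont: "continuous_on {c<..v} f"
    and lim: "(f \<longlongrightarrow> l) (at_right c)" and lt: "\<And>x. x \<in> {c<..v} \<Longrightarrow> f x < l" and "c < v"
  shows "f ` {c<..v} = {f v..<l}"
proof -
  have "(\<lambda>x. - f (- x)) ` {- v..<- c} = {- l<..- f (- (- v))}"
  proof (rule strict_antimono_on_image_at_left)
    show "strict_antimono_on {- v..<- c} (\<lambda>x. - f (- x))"
      using strict_antimono_on_reflect[OF anti] by simp
    show "continuous_on {- v..<- c} (\<lambda>x. - f (- x))"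
      by (intro continuous_intros continuous_on_compose2[OF cont]) auto
    show "((\<lambda>x. - f (- x)) \<longlongrightarrow> - l) (at_left (- c))"
      using lim by (simp only: tendsto_at_left_reflect)
  qed (use lt \<open>c < v\<close> in auto)
  then have "uminus ` (\<lambda>x. - f (- x)) ` {- v..<- c} = uminus ` {- l<..- f v}"
    by simp
  moreover have "uminus ` (\<lambda>x. - f (- x)) ` {- v..<- c} = f ` uminus ` {- v..<- c}"
    by (simp only: image_image minus_minus)
  ultimately show ?thesis by simp
qed

lemma strictly_increasing_on_less:
  assumes "strictly_increasing_on D F" "x \<in> D" "y \<in> D" "x < y" "s \<in> F x" "t \<in> F y"
  shows "s < t"
  using assms unfolding strictly_increasing_on_def by (meson le_less_trans less_le_trans)

theorem theorem4p3:
  fixes a b c :: real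
    and F :: "real \<Rightarrow> real set"
    and \<psi> fs :: "real \<Rightarrow> real"
  assumes "a < b"
    and "F \<in> monotone_usc1 {a..b}"
    and "strictly_increasing_on {a..b} F"
    and "jumps {a..b} F \<subseteq> {a<..<b}"
    and "c \<in> jumps {a..b} F"
    and "jumps {a..b} F \<inter> F c = {c}"
    and "\<exists>p q. p \<le> q \<and> F c = {p..q}"
    and "root_extension a b F \<psi> fs"
    and "jumps {a..b} F \<inter> {Lim (at_right c) fs<..<Lim (at_left c) fs} = {c}"
  defines "D \<equiv> ({a..b} - jumps {a..b} F) \<union> {c}"
    and "f \<equiv> (\<lambda>x. if x = c then {Lim (at_right c) fs..Lim (at_left c) fs} else {fs x})"
  shows "strictly_decreasing_on D f \<and> usc_on D f \<and> square_root_on D F f"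
proof -

  \<comment> \<open>Regular points and the one-sided limits of \<open>fs\<close> at
    \<open>c\<close>\<close>
  define J where "J = jumps {a..b} F"
  define S where "S = {a..b} - J"
  obtain p q where pq: "p \<le> q" "F c = {p..q}" using assms(7) by blast
  have fin: "finite J" and usc: "usc_on {a..b} F" and mf: "multifun_on {a..b} F"
    using assms(2) by (auto simp: monotone_usc1_def monotone_usc_def J_def)
  have cJ: "c \<in> J" and cab: "a < c" "c < b" using assms(4,5) by (auto simp: J_def)
  have Jpq: "J \<inter> {p..q} = {c}" using assms(6) pq by (simp add: J_def)
  have pqab: "{p..q} \<subseteq> {a..b}" proof -
    have "F c \<subseteq> {a..b}" using mf cab by (auto simp: multifun_on_def)
    then show ?thesis using pq by simp
  qed
  have cont: "continuous_on S fs" and anti: "strict_antimono_on S fs"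
    and root: "square_root_on S F (\<lambda>x. {fs x})"
    using assms(8) by (auto simp: root_extension_def S_def J_def)
  have fsS: "fs x \<in> S" if "x \<in> S" for x
    using root that by (auto simp: square_root_on_def multifun_on_def)
  have F: "F x = {fs (fs x)}" if "x \<in> S" for x
    using root that by (auto simp: square_root_on_def numeral_2_eq_2)
  have dec: "fs y < fs x" if "x \<in> S" "y \<in> S" "x < y" for x y
    using anti that by (auto simp: monotone_on_def)
  have cS: "c \<notin> S" using cJ by (simp add: S_def)
  \<comment> \<open>Finitely many jumps are isolated, so a punctured neighbourhood of
    \<open>c\<close> consists of regular points.\<close>
  have "open ({a<..<b} - (J - {c}))"
    using fin by (intro open_Diff finite_imp_closed) auto
  moreover have "c \<in> {a<..<b} - (J - {c})" using cab by simp
  ultimately obtain d where d: "d > 0" "ball c d \<subseteq> {a<..<b} - (J - {c})"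
    using openE by blast
  define u v where "u = c - d" and "v = c + d"
  have uv: "u < c" "c < v" using d by (auto simp: u_def v_def)
  have "x \<in> S" if "u < x" "x < v" "x \<noteq> c" for x
  proof -
    have "x \<in> ball c d" using that by (auto simp: u_def v_def dist_real_def)
    with d(2) that show ?thesis by (force simp: S_def)
  qed
  then have nbhd: "{u<..<c} \<subseteq> S" "{c<..<v} \<subseteq> S"
    using uv by auto
  \<comment> \<open>Boundedness comes from \<open>fs\<close> mapping \<open>S\<close> into itself,
    inside \<open>{a..b}\<close>.\<close>
  have fs_bdd: "bdd_below (fs ` S)" "bdd_above (fs ` S)"
    using fsS by (auto intro!: bdd_belowI[of _ a] bdd_aboveI[of _ b] simp: S_def)
  obtain r where r: "(fs \<longlongrightarrow> r) (at_left c)" "\<And>x. x \<in> S \<Longrightarrow> x < c \<Longrightarrow> r < fs x"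
    using strict_antimono_on_tendsto_at_left[OF anti fs_bdd(1) uv(1) nbhd(1)] by blast
  obtain l where l: "(fs \<longlongrightarrow> l) (at_right c)" "\<And>x. x \<in> S \<Longrightarrow> c < x \<Longrightarrow> fs x < l"
    using strict_antimono_on_tendsto_at_right[OF anti fs_bdd(2) uv(2) nbhd(2)] by blast
  have Lim: "Lim (at_left c) fs = r" "Lim (at_right c) fs = l"
    using r(1) l(1) by (auto intro: tendsto_Lim)
  \<comment> \<open>Since the intersection in the hypothesis is \<open>{c}\<close>, the point
    \<open>c\<close> belongs to the open interval between the limits.\<close>
  have lcr: "l < c" "c < r"
    using assms(9) by (auto simp: Lim)
  have f_c: "f c = {l..r}" and f_S: "x \<in> S \<Longrightarrow> f x = {fs x}" for x
    using cS by (auto simp: f_def Lim)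
  have D_eq: "D = insert c S" by (auto simp: D_def S_def J_def)

  \<comment> \<open>One-sided limits of \<open>F\<close> at \<open>c\<close>\<close>
  have evl: "eventually (\<lambda>x. x \<in> S \<and> x < c) (at_left c)"
    using nbhd uv by (intro eventually_at_leftI[of u]) auto
  have evr: "eventually (\<lambda>x. x \<in> S \<and> c < x) (at_right c)"
    using nbhd uv by (intro eventually_at_rightI[of _ v]) auto
  have F_less: "fs (fs x) < p" if "x \<in> S" "x < c" for x
    using strictly_increasing_on_less[OF assms(3), of x c _ p] that F pq cab by (auto simp: S_def)
  have F_greater: "q < fs (fs x)" if "x \<in> S" "c < x" for x
    using strictly_increasing_on_less[OF assms(3), of c x q] that F pq cab by (auto simp: S_def)
  have usc_c: "eventually (\<lambda>x. x \<in> S \<longrightarrow> fs (fs x) \<in> V) (at c within T)"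
    if V: "open V" "{p..q} \<subseteq> V" for V T
  proof -
    have "c \<in> {a..b}" "F c \<subseteq> V" using V pq cab by auto
    then obtain U where U: "open U" "c \<in> U" "\<forall>x\<in>U \<inter> {a..b}. F x \<subseteq> V"
      using usc V unfolding usc_on_def by meson
    have "x \<in> S \<longrightarrow> fs (fs x) \<in> V" if "x \<in> U" for x
      using bspec[OF U(3), of x] that F[of x] by (auto simp: S_def)
    with U show ?thesis
      unfolding eventually_at_topological by blast
  qed
  \<comment> \<open>A squeeze: upper semi-continuity keeps \<open>fs (fs x)\<close> above any
    \<open>e < p\<close>, and strict monotonicity of \<open>F\<close> keeps it below
    \<open>p\<close>.\<close>
  have limp: "((\<lambda>x. fs (fs x)) \<longlongrightarrow> p) (at_left c)"
  proof (rule order_tendstoI)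
    fix e assume "e < p"
    then have "eventually (\<lambda>x. x \<in> S \<longrightarrow> fs (fs x) \<in> {e<..}) (at_left c)"
      by (intro usc_c) auto
    with evl show "eventually (\<lambda>x. e < fs (fs x)) (at_left c)"
      by eventually_elim simp
  next
    fix e assume "p < e"
    from evl show "eventually (\<lambda>x. fs (fs x) < e) (at_left c)"
      by eventually_elim (use F_less \<open>p < e\<close> in force)
  qed
  have limq: "((\<lambda>x. fs (fs x)) \<longlongrightarrow> q) (at_right c)"
  proof (rule order_tendstoI)
    fix e assume "q < e"
    then have "eventually (\<lambda>x. x \<in> S \<longrightarrow> fs (fs x) \<in> {..<e}) (at_right c)"
      by (intro usc_c) auto
    with evr show "eventually (\<lambda>x. fs (fs x) < e) (at_right c)"
      by eventually_elim simp
  next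
    fix e assume "e < q"
    from evr show "eventually (\<lambda>x. e < fs (fs x)) (at_right c)"
      by eventually_elim (use F_greater \<open>e < q\<close> in force)
  qed

  \<comment> \<open>Values and images of \<open>fs\<close> on the interval from \<open>l\<close> to
    \<open>r\<close>\<close>
  have "p \<le> l"
  proof (rule tendsto_upperbound[OF limp])
    show "eventually (\<lambda>x. fs (fs x) \<le> l) (at_left c)"
      using evl
    proof eventually_elim
      case (elim x)
      then have "c < fs x" using r(2)[of x] lcr by simp
      with elim show ?case using l(2)[of "fs x"] fsS by simp
    qed
  qed simp
  moreover have "r \<le> q"
  proof (rule tendsto_lowerbound[OF limq])
    show "eventually (\<lambda>x. r \<le> fs (fs x)) (at_right c)"
      using evr
    proof eventually_elim
      case (elim x)
      then have "fs x < c" using l(2)[of x] lcr by simp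
      with elim show ?case using r(2)[of "fs x"] fsS by simp
    qed
  qed simp
  ultimately have lr_S: "{l..<c} \<subseteq> S" "{c<..r} \<subseteq> S"
    using Jpq pqab lcr by (fastforce simp: S_def)+
  have lr_eq: "{l..r} = {l..<c} \<union> {c} \<union> {c<..r}" using lcr by auto
  have lS: "l \<in> S" and rS: "r \<in> S" using lr_S lcr by auto
  \<comment> \<open>As \<open>r\<close> is now known to be a regular point, continuity there carries
    the limit through the outer \<open>fs\<close>. Uniqueness of limits then identifies
    \<open>fs r\<close> with \<open>p\<close>; the argument at \<open>l\<close> is
    symmetric.\<close>
  have "((\<lambda>x. fs (fs x)) \<longlongrightarrow> fs r) (at_left c)"
    by (rule continuous_on_tendsto_compose[OF cont r(1) rS], rule eventually_mono[OF evl]) (simp add: fsS)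
  then have fs_r: "fs r = p"
    by (rule tendsto_unique[OF trivial_limit_at_left_real _ limp])
  have "((\<lambda>x. fs (fs x)) \<longlongrightarrow> fs l) (at_right c)"
    by (rule continuous_on_tendsto_compose[OF cont l(1) lS], rule eventually_mono[OF evr]) (simp add: fsS)
  then have fs_l: "fs l = q"
    by (rule tendsto_unique[OF trivial_limit_at_right_real _ limq])
  have "fs ` {l..<c} = {r<..q}"
    unfolding fs_l[symmetric] using lr_S lcr
    by (intro strict_antimono_on_image_at_left r)
      (auto intro: continuous_on_subset[OF cont] monotone_on_subset[OF anti])
  moreover have "fs ` {c<..r} = {p..<l}"
    unfolding fs_r[symmetric] using lr_S lcr
    by (intro strict_antimono_on_image_at_right l)
      (auto intro: continuous_on_subset[OF cont] monotone_on_subset[OF anti])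
  moreover have "(\<Union>y\<in>{l..r}. f y) = fs ` {l..<c} \<union> f c \<union> fs ` {c<..r}"
  proof -
    have "(\<Union>y\<in>{l..<c}. f y) = fs ` {l..<c}" "(\<Union>y\<in>{c<..r}. f y) = fs ` {c<..r}"
      using lr_S f_S by blast+
    then show ?thesis by (simp add: lr_eq Un_ac)
  qed
  ultimately have root_c: "(\<Union>y\<in>f c. f y) = F c"
    using \<open>p \<le> l\<close> \<open>r \<le> q\<close> lcr by (auto simp: f_c pq)

  \<comment> \<open>Root equation, monotonicity and upper semi-continuity of
    \<open>f\<close>\<close>
  have "square_root_on D F f"
    unfolding square_root_on_def multifun_on_def
  proof (intro conjI ballI)
    fix x assume "x \<in> D"
    then consider "x = c" | "x \<in> S" by (auto simp: D_eq)
    then show "f x \<noteq> {}" "f x \<subseteq> D" "miter f 2 x = F x"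
    proof (atomize (full), cases)
      case 1
      have "{l..r} \<subseteq> D" using lr_S by (auto simp: lr_eq D_eq)
      with 1 show "f x \<noteq> {} \<and> f x \<subseteq> D \<and> miter f 2 x = F x"
        using lcr root_c by (simp add: f_c numeral_2_eq_2)
    next
      case 2
      then show "f x \<noteq> {} \<and> f x \<subseteq> D \<and> miter f 2 x = F x"
        using fsS F by (simp add: f_S D_eq numeral_2_eq_2)
    qed
  qed
  moreover have "strictly_decreasing_on D f"
    unfolding strictly_decreasing_on_def using r(2) l(2) dec lcr
    by (auto simp: D_eq f_c f_S intro: less_imp_le)
  moreover have "usc_on D f"
    unfolding usc_on_def
  proof (intro ballI allI impI, elim conjE)
    fix x V assume x: "x \<in> D" and V: "open V" "f x \<subseteq> V"
    have "eventually (\<lambda>y. y \<in> D \<longrightarrow> f y \<subseteq> V) (nhds x)"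
    proof (cases "x = c")
      case True
      \<comment> \<open>Both one-sided limits are endpoints of \<open>f c\<close>, hence lie in the
        open set \<open>V\<close>.\<close>
      have "eventually (\<lambda>y. fs y \<in> V) (at_left c)" "eventually (\<lambda>y. fs y \<in> V) (at_right c)"
        using V True lcr by (auto simp: f_c intro!: topological_tendstoD[OF r(1)] topological_tendstoD[OF l(1)])
      then have "eventually (\<lambda>y. fs y \<in> V) (at c)"
        by (simp add: eventually_at_split)
      then show ?thesis
        unfolding True eventually_at_filter
        by eventually_elim (use V True in \<open>auto simp: D_eq f_S\<close>)
    next
      case False
      then have xS: "x \<in> S" using x by (simp add: D_eq)
      then have "(fs \<longlongrightarrow> fs x) (at x within S)"
        using cont by (simp add: continuous_on_def)
      then have "eventually (\<lambda>y. fs y \<in> V) (at x within S)"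
        using V xS by (intro topological_tendstoD) (auto simp: f_S)
      \<comment> \<open>Staying away from \<open>c\<close> ensures that \<open>f y\<close> is the
        singleton \<open>{fs y}\<close> at all nearby points of \<open>D\<close>.\<close>
      moreover have "eventually (\<lambda>y. y \<noteq> c) (nhds x)"
        using False by (rule t1_space_nhds)
      ultimately show ?thesis
        unfolding eventually_at_filter
        by eventually_elim (use V xS in \<open>auto simp: D_eq f_S\<close>)
    qed
    then show "\<exists>U. open U \<and> x \<in> U \<and> (\<forall>y\<in>U \<inter> D. f y \<subseteq> V)"
      by (auto simp: eventually_nhds)
  qed
  ultimately show ?thesis by blast
qed

end
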